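(* Let $f_1,f_2:\mathbb{R}^n\to(-\infty,\infty]$ be proper closed convex functions such that $f_1$ is $\sigma_1$-convex with $\sigma_1\ge0$ and $f_2$ is $\sigma_2$-convex with $\sigma_2>0$. Assume that there is a closed set $Y\subseteq\mathbb{R}^n$ with $\mathrm{dom}(f_1)\subseteq Y\subseteq \mathrm{int}(\mathrm{dom}(f_2))$, and that $f:=f_1-f_2$ is bounded below, i.e. there is a scalar $f^*\in\mathbb{R}$ with $f(x)\ge f^*$ for all $x\in\mathbb{R}^n$. Let $\lambda\in(0,1)$, $t\in(0,1]$, $\bar\sigma=\sigma_1(1-t)+\sigma_2-\lambda\sigma_2/t$, and $\gamma\in[0,\bar\sigma/2)$. Let $\{x^k\}$ be a sequence generated by the inexact refined inertial DC algorithm RInDCA$_{\mathrm n}$ with parameters $\lambda,\gamma$. Then: (i) $\lim_{k\to\infty}\|x^k-x^{k-1}\|=0$; (ii) if $\{x^k\}$ is bounded, then any limit point of $\{x^k\}$ is a critical point of the problem $\min\{f_1(x)-f_2(x):x\in\mathbb{R}^n\}$.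
   Context: $\mathrm{dom}(h)=\{x: h(x)<\infty\}$; $\|\cdot\|$ is the Euclidean norm; $\partial h$ denotes the convex subdifferential of a convex function $h$. For $\varepsilon\ge0$, the $\varepsilon$-subdifferential is $\partial_\varepsilon h(x)=\{y: h(z)\ge h(x)+\langle y,z-x\rangle-\varepsilon\ \text{for all } z\in\mathbb{R}^n\}$ (so $\partial_0h=\partial h$), and it is empty if $x\notin\mathrm{dom}(h)$. The function $f=f_1-f_2$ takes the value $+\infty$ outside $\mathrm{dom}(f_1)$. A function is closed if its epigraph is closed. A proper closed function $h$ is $\sigma$-convex ($\sigma\ge0$) if for all $x,z\in\mathrm{dom}(h)$ and $\theta\in[0,1]$: $h(\theta x+(1-\theta)z)\le\theta h(x)+(1-\theta)h(z)-\frac{\sigma}{2}\theta(1-\theta)\|x-z\|^2$. RInDCA$_{\mathrm n}$ (with parameters $\lambda,\gamma$): start from $x^0\in\mathrm{dom}(f_1)$ and $x^{-1}=x^0$. For $k=0,1,2,\dots$, find $x^{k+1}\in\mathbb{R}^n$ such that $\partial_{\varepsilon_{k+1}}f_1(x^{k+1})\cap\big(\partial f_2(x^k)+\gamma(x^k-x^{k-1})\big)\ne\emptyset$ for some $\varepsilon_{k+1}$ with $0\le\varepsilon_{k+1}\le\lambda\frac{\sigma_2}{2}\|x^{k+1}-x^k\|^2$. "A sequence generated by the algorithm" is any infinite sequence satisfying these relations. A point $\bar x$ is a critical point of the problem if $\partial f_1(\bar x)\cap\partial f_2(\bar x)\neq\emptyset$. *)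

theory Defs
  imports "HOL-Analysis.Analysis"
begin

definition eff_dom :: "('a \<Rightarrow> ereal) \<Rightarrow> 'a set" where
  "eff_dom h = {x. h x < \<infinity>}"

definition proper_fun :: "('a \<Rightarrow> ereal) \<Rightarrow> bool" where
  "proper_fun h \<longleftrightarrow> (\<forall>x. h x \<noteq> -\<infinity>) \<and> eff_dom h \<noteq> {}"

text \<open>The library's epigraph is only for real-valued functions; as there, only points with a
  real second component are collected.\<close>

definition ereal_epigraph :: "('a \<Rightarrow> ereal) \<Rightarrow> ('a \<times> real) set" where
  "ereal_epigraph h = {(x, r). h x \<le> ereal r}"

definition closed_fun :: "('a::topological_space \<Rightarrow> ereal) \<Rightarrow> bool" where
  "closed_fun h \<longleftrightarrow> closed (ereal_epigraph h)"

definition convex_fun :: "('a::real_vector \<Rightarrow> ereal) \<Rightarrow> bool" where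
  "convex_fun h \<longleftrightarrow> convex (ereal_epigraph h)"

text \<open>On the effective domain of a proper function all terms on the right-hand side are finite,
  so the extended-real operations never meet an indeterminate form.\<close>

definition sigma_convex :: "real \<Rightarrow> ('a::real_normed_vector \<Rightarrow> ereal) \<Rightarrow> bool" where
  "sigma_convex \<sigma> h \<longleftrightarrow> 0 \<le> \<sigma> \<and> proper_fun h \<and> closed_fun h \<and>
     (\<forall>x\<in>eff_dom h. \<forall>z\<in>eff_dom h. \<forall>\<theta>\<in>{0..1}.
        h (\<theta> *\<^sub>R x + (1 - \<theta>) *\<^sub>R z)
          \<le> ereal \<theta> * h x + ereal (1 - \<theta>) * h z - ereal (\<sigma> / 2 * \<theta> * (1 - \<theta>) * (norm (x - z))\<^sup>2))"

definition subdifferential :: "('a::real_inner \<Rightarrow> ereal) \<Rightarrow> 'a \<Rightarrow> 'a set" where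
  "subdifferential h x = {y. x \<in> eff_dom h \<and> (\<forall>z. h z \<ge> h x + ereal (y \<bullet> (z - x)))}"

definition eps_subdifferential :: "real \<Rightarrow> ('a::real_inner \<Rightarrow> ereal) \<Rightarrow> 'a \<Rightarrow> 'a set" where
  "eps_subdifferential \<epsilon> h x =
     {y. x \<in> eff_dom h \<and> (\<forall>z. h z \<ge> h x + ereal (y \<bullet> (z - x)) - ereal \<epsilon>)}"

lemma eps_subdifferential_0: "eps_subdifferential 0 h x = subdifferential h x"
  by (simp add: eps_subdifferential_def subdifferential_def zero_ereal_def[symmetric])

text \<open>The case distinction avoids relying on the value of \<open>\<infinity> - \<infinity>\<close> in \<^typ>\<open>ereal\<close>.\<close>

definition dc_objective :: "('a \<Rightarrow> ereal) \<Rightarrow> ('a \<Rightarrow> ereal) \<Rightarrow> 'a \<Rightarrow> ereal" where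
  "dc_objective f1 f2 x = (if x \<in> eff_dom f1 then f1 x - f2 x else \<infinity>)"

text \<open>The iterate preceding \<open>x k\<close>, with the initialisation convention that the iterate of
  index \<open>-1\<close> is \<open>x 0\<close>.\<close>

definition prev_iterate :: "(nat \<Rightarrow> 'a) \<Rightarrow> nat \<Rightarrow> 'a" where
  "prev_iterate x k = (case k of 0 \<Rightarrow> x 0 | Suc j \<Rightarrow> x j)"

text \<open>The predicate holds for the infinite sequences generated by the inexact refined inertial DC
  algorithm; \<open>\<sigma>2\<close> is the convexity modulus of \<open>f2\<close>.\<close>

definition RInDCA_n_sequence ::
  "('a::real_inner \<Rightarrow> ereal) \<Rightarrow> ('a \<Rightarrow> ereal) \<Rightarrow> real \<Rightarrow> real \<Rightarrow> real \<Rightarrow> (nat \<Rightarrow> 'a) \<Rightarrow> bool" where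
  "RInDCA_n_sequence f1 f2 \<sigma>2 lam \<gamma> x \<longleftrightarrow>
     x 0 \<in> eff_dom f1 \<and>
     (\<forall>k. \<exists>\<epsilon>. 0 \<le> \<epsilon> \<and> \<epsilon> \<le> lam * (\<sigma>2 / 2) * (norm (x (Suc k) - x k))\<^sup>2 \<and>
        eps_subdifferential \<epsilon> f1 (x (Suc k)) \<inter>
          (\<lambda>v. v + \<gamma> *\<^sub>R (x k - prev_iterate x k)) ` subdifferential f2 (x k) \<noteq> {})"

definition critical_point :: "('a::real_inner \<Rightarrow> ereal) \<Rightarrow> ('a \<Rightarrow> ereal) \<Rightarrow> 'a \<Rightarrow> bool" where
  "critical_point f1 f2 x \<longleftrightarrow> subdifferential f1 x \<inter> subdifferential f2 x \<noteq> {}"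

text \<open>Limit points of a sequence are limits of subsequences, which differs from
  \<open>islimpt\<close> applied to the range of the sequence (e.g. for constant sequences).\<close>

definition seq_limit_point :: "'a::topological_space \<Rightarrow> (nat \<Rightarrow> 'a) \<Rightarrow> bool" where
  "seq_limit_point l x \<longleftrightarrow> (\<exists>r. strict_mono r \<and> (x \<circ> r) \<longlonglongrightarrow> l)"

end

theory Submission
  imports Defs
begin

text \<open>Testing the \<open>\<epsilon>\<close>-subgradient inequality at \<open>u + t (z - u)\<close> and using strong convexity gives
  a quadratically improved inequality with error \<open>\<epsilon> / t\<close>. Applied to both \<open>f1\<close> and \<open>f2\<close> between
  consecutive iterates, it makes \<open>f (x k) + \<gamma>/2 \<parallel>x k - x (k-1)\<parallel>\<^sup>2\<close> decrease by at least
  \<open>(\<sigma>bar/2 - \<gamma>) \<parallel>x (k+1) - x k\<parallel>\<^sup>2\<close>, so the squared steps are summable. At a limit point, which lies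
  in \<open>Y\<close> and hence in the interior of the domain of \<open>f2\<close>, the subgradients of \<open>f2\<close> along the
  subsequence are bounded; any of their limit points is a common subgradient of \<open>f1\<close> and \<open>f2\<close>,
  because \<open>\<epsilon>\<close>-subdifferentials of closed functions have closed graphs.\<close>

lemma proper_fun_ereal_real:
  assumes "proper_fun h" "x \<in> eff_dom h"
  shows "h x = ereal (real_of_ereal (h x))"
proof -
  have "h x \<noteq> -\<infinity>" "h x \<noteq> \<infinity>"
    using assms by (auto simp: proper_fun_def eff_dom_def)
  then show ?thesis by (cases "h x") auto
qed

text \<open>Both values are finite on the domain of a proper function, so the later estimates can be
  carried out in the reals instead of \<open>ereal\<close>.\<close>

lemma eps_subdifferential_realD:
  assumes "proper_fun h" "y \<in> eps_subdifferential \<epsilon> h x" "z \<in> eff_dom h"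
  shows "real_of_ereal (h x) + y \<bullet> (z - x) - \<epsilon> \<le> real_of_ereal (h z)"
proof -
  have "x \<in> eff_dom h" and le: "h x + ereal (y \<bullet> (z - x)) - ereal \<epsilon> \<le> h z"
    using assms(2) by (auto simp: eps_subdifferential_def)
  obtain a b where "h x = ereal a" "h z = ereal b"
    using proper_fun_ereal_real assms(1,3) \<open>x \<in> eff_dom h\<close> by metis
  with le show ?thesis by simp
qed

lemma sigma_convex_realD:
  fixes h :: "'a::real_normed_vector \<Rightarrow> ereal"
  assumes "sigma_convex \<sigma> h" "x \<in> eff_dom h" "z \<in> eff_dom h" "\<theta> \<in> {0..1}"
  shows "\<theta> *\<^sub>R x + (1 - \<theta>) *\<^sub>R z \<in> eff_dom h"
    and "real_of_ereal (h (\<theta> *\<^sub>R x + (1 - \<theta>) *\<^sub>R z))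
      \<le> \<theta> * real_of_ereal (h x) + (1 - \<theta>) * real_of_ereal (h z)
         - \<sigma> / 2 * \<theta> * (1 - \<theta>) * (norm (x - z))\<^sup>2"
proof -
  let ?w = "\<theta> *\<^sub>R x + (1 - \<theta>) *\<^sub>R z"
  have proper: "proper_fun h"
    and le: "h ?w \<le> ereal \<theta> * h x + ereal (1 - \<theta>) * h z
      - ereal (\<sigma> / 2 * \<theta> * (1 - \<theta>) * (norm (x - z))\<^sup>2)"
    using assms by (auto simp: sigma_convex_def)
  obtain a b where ab: "h x = ereal a" "h z = ereal b"
    using proper_fun_ereal_real proper assms(2,3) by metis
  show w: "?w \<in> eff_dom h"
    using le unfolding ab eff_dom_def by auto
  obtain c where "h ?w = ereal c"
    using proper_fun_ereal_real proper w by metis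
  then show "real_of_ereal (h ?w) \<le> \<theta> * real_of_ereal (h x) + (1 - \<theta>) * real_of_ereal (h z)
      - \<sigma> / 2 * \<theta> * (1 - \<theta>) * (norm (x - z))\<^sup>2"
    using le by (simp add: ab)
qed

text \<open>The parameter \<open>t\<close> is a trade-off: a small \<open>t\<close> keeps most of
  the modulus \<open>\<sigma>\<close> but magnifies the error. It enters \<open>\<sigma>bar\<close>
  in the same way.\<close>

lemma sigma_convex_eps_subgradient:
  fixes h :: "'a::real_inner \<Rightarrow> ereal"
  assumes h: "sigma_convex \<sigma> h" and y: "y \<in> eps_subdifferential \<epsilon> h u"
    and z: "z \<in> eff_dom h" and t: "t \<in> {0<..1}"
  shows "real_of_ereal (h u) + y \<bullet> (z - u) + \<sigma> / 2 * (1 - t) * (norm (z - u))\<^sup>2 - \<epsilon> / t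
    \<le> real_of_ereal (h z)"
proof -
  have u: "u \<in> eff_dom h" and proper: "proper_fun h"
    using h y by (auto simp: eps_subdifferential_def sigma_convex_def)
  let ?w = "t *\<^sub>R z + (1 - t) *\<^sub>R u"
  have t': "t \<in> {0..1}" using t by auto
  note w = sigma_convex_realD[OF h z u t']
  have wu: "?w - u = t *\<^sub>R (z - u)" by (simp add: algebra_simps)
  have "real_of_ereal (h u) + t * (y \<bullet> (z - u)) - \<epsilon> \<le> real_of_ereal (h ?w)"
    using eps_subdifferential_realD[OF proper y w(1)] by (simp add: wu)
  also have "\<dots> \<le> t * real_of_ereal (h z) + (1 - t) * real_of_ereal (h u)
      - \<sigma> / 2 * t * (1 - t) * (norm (z - u))\<^sup>2"
    by (rule w(2))
  \<comment> \<open>The terms in \<open>h u\<close> combine to \<open>t\<close> times its value, so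
    \<open>t\<close> factors out and only the error is divided by it.\<close>
  finally have "t * (real_of_ereal (h u) + y \<bullet> (z - u) + \<sigma> / 2 * (1 - t) * (norm (z - u))\<^sup>2 - \<epsilon> / t)
      \<le> t * real_of_ereal (h z)"
    using t by (simp add: algebra_simps)
  then show ?thesis using t by simp
qed

text \<open>An exact subgradient has error zero for every \<open>t\<close>, so letting
  \<open>t\<close> tend to 0 from the right recovers the full modulus; \<open>t = 0\<close> itself
  is outside the range of the previous inequality.\<close>

lemma sigma_convex_subgradient:
  fixes h :: "'a::real_inner \<Rightarrow> ereal"
  assumes h: "sigma_convex \<sigma> h" and y: "y \<in> subdifferential h u" and z: "z \<in> eff_dom h"
  shows "real_of_ereal (h u) + y \<bullet> (z - u) + \<sigma> / 2 * (norm (z - u))\<^sup>2 \<le> real_of_ereal (h z)"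
proof -
  let ?f = "\<lambda>t. real_of_ereal (h u) + y \<bullet> (z - u) + \<sigma> / 2 * (1 - t) * (norm (z - u))\<^sup>2"
  have "(?f \<longlongrightarrow> ?f 0) (at_right 0)"
    by (intro tendsto_intros)
  moreover have "\<forall>\<^sub>F t in at_right (0::real). ?f t \<le> real_of_ereal (h z)"
  proof -
    have "\<forall>\<^sub>F t in at_right (0::real). t \<in> {0<..<1}"
      by (rule eventually_at_right_real) simp
    then show ?thesis
    proof eventually_elim
      case (elim t)
      then show ?case
        using sigma_convex_eps_subgradient[OF h, of y 0 u z t] y z
        by (simp add: eps_subdifferential_0)
    qed
  qed
  ultimately have "?f 0 \<le> real_of_ereal (h z)"
    by (rule tendsto_upperbound) simp
  then show ?thesis by simp
qed

text \<open>For fixed \<open>z\<close> the subgradient inequality puts a point over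
  \<open>u k\<close> into the epigraph. These points converge, and closedness of the epigraph keeps
  their limit inside, so the argument does not rest on continuity of \<open>h\<close>.\<close>

lemma eps_subdifferential_closed_graph:
  fixes h :: "'a::real_inner \<Rightarrow> ereal"
  assumes "proper_fun h" "closed_fun h"
    and y: "\<And>k. y k \<in> eps_subdifferential (\<epsilon> k) h (u k)"
    and lim: "u \<longlonglongrightarrow> u'" "y \<longlonglongrightarrow> y'" "\<epsilon> \<longlonglongrightarrow> \<epsilon>'"
  shows "y' \<in> eps_subdifferential \<epsilon>' h u'"
proof -
  have le: "h u' \<le> ereal (real_of_ereal (h z) - y' \<bullet> (z - u') + \<epsilon>')" if z: "z \<in> eff_dom h" for z
  proof -
    let ?p = "\<lambda>k. (u k, real_of_ereal (h z) - y k \<bullet> (z - u k) + \<epsilon> k)"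
    have "?p k \<in> ereal_epigraph h" for k
    proof -
      have "u k \<in> eff_dom h" using y by (auto simp: eps_subdifferential_def)
      then obtain c where "h (u k) = ereal c"
        using proper_fun_ereal_real[OF assms(1)] by metis
      then show ?thesis
        using eps_subdifferential_realD[OF assms(1) y z, of k] by (simp add: ereal_epigraph_def)
    qed
    moreover have "?p \<longlonglongrightarrow> (u', real_of_ereal (h z) - y' \<bullet> (z - u') + \<epsilon>')"
      by (intro tendsto_intros lim)
    ultimately have "(u', real_of_ereal (h z) - y' \<bullet> (z - u') + \<epsilon>') \<in> ereal_epigraph h"
      by (rule closed_sequentially[OF assms(2)[unfolded closed_fun_def]])
    then show ?thesis by (simp add: ereal_epigraph_def)
  qed
  \<comment> \<open>Any finite upper bound on \<open>h u'\<close> puts \<open>u'\<close> in the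
    domain; properness supplies one \<open>z0\<close> to test with.\<close>
  obtain z0 where "z0 \<in> eff_dom h"
    using assms(1) by (auto simp: proper_fun_def)
  from le[OF this] have u': "u' \<in> eff_dom h"
    by (auto simp: eff_dom_def intro: le_less_trans)
  then obtain a where a: "h u' = ereal a"
    using proper_fun_ereal_real[OF assms(1)] by metis
  have "h u' + ereal (y' \<bullet> (z - u')) - ereal \<epsilon>' \<le> h z" for z
  proof (cases "z \<in> eff_dom h")
    case True
    then obtain b where "h z = ereal b"
      using proper_fun_ereal_real[OF assms(1)] by metis
    with le[OF True] a show ?thesis by simp
  next
    case False
    then show ?thesis by (simp add: eff_dom_def)
  qed
  with u' show ?thesis by (simp add: eps_subdifferential_def)
qed

text \<open>A finite convex function on an open ball in finite dimension is continuous, hence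
  bounded on a smaller compact ball. Moving by \<open>e\<close> in the direction of a subgradient
  \<open>v\<close> raises \<open>h\<close> by at least \<open>e * norm v\<close>, so a large
  \<open>v\<close> would break that bound.\<close>

lemma subdifferential_locally_bounded:
  fixes h :: "'a::euclidean_space \<Rightarrow> ereal"
  assumes h: "sigma_convex \<sigma> h" and u: "u \<in> interior (eff_dom h)"
  obtains e B where "e > 0" "\<And>w v. w \<in> ball u e \<Longrightarrow> v \<in> subdifferential h w \<Longrightarrow> norm v \<le> B"
proof -
  define g where "g = (\<lambda>w. real_of_ereal (h w))"
  have proper: "proper_fun h" and \<sigma>: "0 \<le> \<sigma>"
    using h by (auto simp: sigma_convex_def)
  obtain e0 where e0: "e0 > 0" "ball u e0 \<subseteq> eff_dom h"
    using u by (auto simp: mem_interior)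
  \<comment> \<open>A third suffices: a step of length \<open>e\<close> from \<open>ball u e\<close>
    stays in \<open>cball u (2 * e)\<close>, which lies inside \<open>ball u e0\<close>.\<close>
  define e where "e = e0 / 3"
  have e: "e > 0" "cball u (2 * e) \<subseteq> ball u e0"
    using e0(1) by (auto simp: e_def)
  have "convex_on (ball u e0) g"
  proof (rule convex_onI)
    fix t :: real and x y assume t: "0 < t" "t < 1" and xy: "x \<in> ball u e0" "y \<in> ball u e0"
    have "g ((1 - t) *\<^sub>R x + (1 - (1 - t)) *\<^sub>R y)
        \<le> (1 - t) * g x + (1 - (1 - t)) * g y - \<sigma> / 2 * (1 - t) * (1 - (1 - t)) * (norm (x - y))\<^sup>2"
      unfolding g_def using t xy e0(2) by (intro sigma_convex_realD(2)[OF h]) auto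
    moreover have "0 \<le> \<sigma> / 2 * (1 - t) * (1 - (1 - t)) * (norm (x - y))\<^sup>2"
      using \<sigma> t by simp
    ultimately show "g ((1 - t) *\<^sub>R x + t *\<^sub>R y) \<le> (1 - t) * g x + t * g y" by simp
  qed simp
  then have "continuous_on (ball u e0) g"
    by (intro convex_on_continuous) auto
  then have "compact (g ` cball u (2 * e))"
    using e(2) by (intro compact_continuous_image compact_cball) (rule continuous_on_subset)
  then obtain M where M: "\<And>w. w \<in> cball u (2 * e) \<Longrightarrow> \<bar>g w\<bar> \<le> M"
    using compact_imp_bounded by (force simp: bounded_iff)
  have "norm v \<le> 2 * M / e" if w: "w \<in> ball u e" and v: "v \<in> subdifferential h w" for w v
  proof -
    \<comment> \<open>If \<open>v = 0\<close>, then \<open>sgn v = 0\<close> and \<open>?z\<close>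
      is just \<open>w\<close>; the estimates below still hold.\<close>
    let ?z = "w + e *\<^sub>R sgn v"
    have "dist u ?z \<le> dist u w + norm (e *\<^sub>R sgn v)"
      using norm_triangle_ineq4[of "u - w" "e *\<^sub>R sgn v"] by (simp add: dist_norm algebra_simps)
    also have "\<dots> \<le> 2 * e"
      using w e(1) by (simp add: norm_sgn)
    finally have z: "?z \<in> cball u (2 * e)" by simp
    have w': "w \<in> cball u (2 * e)" using w e(1) by simp
    have zdom: "?z \<in> eff_dom h" using z e(2) e0(2) by blast
    have "v \<in> eps_subdifferential 0 h w" using v by (simp add: eps_subdifferential_0)
    from eps_subdifferential_realD[OF proper this zdom] have "g w + e * (v \<bullet> sgn v) \<le> g ?z"
      by (simp add: g_def)
    moreover have "v \<bullet> sgn v = norm v"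
      by (cases "v = 0") (simp_all add: sgn_div_norm dot_square_norm power2_eq_square)
    ultimately have "g w + e * norm v \<le> g ?z" by simp
    with M[OF z] M[OF w'] have "e * norm v \<le> 2 * M" by linarith
    then show ?thesis using e(1) by (simp add: field_simps)
  qed
  with e(1) show ?thesis using that by blast
qed

text \<open>The partial sums of \<open>s\<close> are bounded by the total drop of \<open>E\<close>,
  which is at most \<open>E 0 - m\<close>.\<close>

lemma summable_telescoping_nonneg:
  fixes E s :: "nat \<Rightarrow> real"
  assumes "\<And>k. 0 \<le> s k" "\<And>k. E (Suc k) + s k \<le> E k" "\<And>k. m \<le> E k"
  shows "summable s"
proof (rule summableI_nonneg_bounded)
  fix n
  have "E n + (\<Sum>k<n. s k) \<le> E 0"
  proof (induction n)
    case (Suc n)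
    with assms(2)[of n] show ?case by simp
  qed simp
  with assms(3)[of n] show "(\<Sum>k<n. s k) \<le> E 0 - m" by linarith
qed (rule assms(1))

theorem theorem2:
  fixes f1 f2 :: "real ^ 'n \<Rightarrow> ereal"
    and \<sigma>1 \<sigma>2 lam t \<sigma>bar \<gamma> fstar :: real
    and Y :: "(real ^ 'n) set"
    and x :: "nat \<Rightarrow> real ^ 'n"
  assumes "proper_fun f1" and "closed_fun f1" and "convex_fun f1"
    and "proper_fun f2" and "closed_fun f2" and "convex_fun f2"
    and "\<sigma>1 \<ge> 0" and "sigma_convex \<sigma>1 f1"
    and "\<sigma>2 > 0" and "sigma_convex \<sigma>2 f2"
    and "closed Y" and "eff_dom f1 \<subseteq> Y" and "Y \<subseteq> interior (eff_dom f2)"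
    and "\<forall>z. dc_objective f1 f2 z \<ge> ereal fstar"
    and "lam \<in> {0<..<1}" and "t \<in> {0<..1}"
    and "\<sigma>bar = \<sigma>1 * (1 - t) + \<sigma>2 - lam * \<sigma>2 / t"
    and "\<gamma> \<in> {0..<\<sigma>bar / 2}"
    and "RInDCA_n_sequence f1 f2 \<sigma>2 lam \<gamma> x"
  shows "(\<lambda>k. norm (x k - prev_iterate x k)) \<longlonglongrightarrow> 0 \<and>
    (bounded (range x) \<longrightarrow> (\<forall>xbar. seq_limit_point xbar x \<longrightarrow> critical_point f1 f2 xbar))"
proof -
  note cvx1 = assms(8) and cvx2 = assms(10) and dom1 = assms(12) and dom2 = assms(13)
    and t = assms(16) and \<gamma> = assms(18) and seq = assms(19)

  \<comment> \<open>Steps, errors and subgradients along the sequence\<close>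
  define d where "d = (\<lambda>k. x k - prev_iterate x k)"
  have d_Suc: "d (Suc k) = x (Suc k) - x k" for k
    by (simp add: d_def prev_iterate_def)
  have "\<forall>k. \<exists>\<epsilon> v. 0 \<le> \<epsilon> \<and> \<epsilon> \<le> lam * (\<sigma>2 / 2) * (norm (d (Suc k)))\<^sup>2 \<and>
      v \<in> subdifferential f2 (x k) \<and> v + \<gamma> *\<^sub>R d k \<in> eps_subdifferential \<epsilon> f1 (x (Suc k))"
  proof
    fix k
    obtain \<epsilon> v where "0 \<le> \<epsilon>" "\<epsilon> \<le> lam * (\<sigma>2 / 2) * (norm (x (Suc k) - x k))\<^sup>2"
      "v \<in> subdifferential f2 (x k)"
      "v + \<gamma> *\<^sub>R (x k - prev_iterate x k) \<in> eps_subdifferential \<epsilon> f1 (x (Suc k))"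
      using seq unfolding RInDCA_n_sequence_def by blast
    then show "\<exists>\<epsilon> v. 0 \<le> \<epsilon> \<and> \<epsilon> \<le> lam * (\<sigma>2 / 2) * (norm (d (Suc k)))\<^sup>2 \<and>
      v \<in> subdifferential f2 (x k) \<and> v + \<gamma> *\<^sub>R d k \<in> eps_subdifferential \<epsilon> f1 (x (Suc k))"
      unfolding d_Suc unfolding d_def by blast
  qed
  \<comment> \<open>\<open>\<epsilon> k\<close> is the error at the iterate of index
    \<open>Suc k\<close>, while \<open>v k\<close> belongs to \<open>x k\<close>. The first inertial
    term vanishes, since \<open>d 0 = 0\<close>.\<close>
  then obtain \<epsilon> v where \<epsilon>: "\<And>k. 0 \<le> \<epsilon> k" "\<And>k. \<epsilon> k \<le> lam * (\<sigma>2 / 2) * (norm (d (Suc k)))\<^sup>2"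
    and v: "\<And>k. v k \<in> subdifferential f2 (x k)"
    and y: "\<And>k. v k + \<gamma> *\<^sub>R d k \<in> eps_subdifferential (\<epsilon> k) f1 (x (Suc k))"
    by metis
  have x1: "x k \<in> eff_dom f1" for k
    using y seq by (cases k) (auto simp: eps_subdifferential_def RInDCA_n_sequence_def)
  have x2: "x k \<in> eff_dom f2" for k
    using v by (auto simp: subdifferential_def)

  \<comment> \<open>Energy descent\<close>
  define a b where "a = (\<lambda>k. real_of_ereal (f1 (x k)))" and "b = (\<lambda>k. real_of_ereal (f2 (x k)))"
  have bound: "fstar \<le> a k - b k" for k
  proof -
    have "f1 (x k) = ereal (a k)" "f2 (x k) = ereal (b k)"
      unfolding a_def b_def by (intro proper_fun_ereal_real assms(1,4) x1 x2)+
    then show ?thesis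
      using assms(14)[rule_format, of "x k"] x1[of k] by (simp add: dc_objective_def)
  qed
  \<comment> \<open>Half of the bound on the inertial cross term is charged to the previous step,
    hence the weight \<open>\<gamma> / 2\<close>. The other half and the weight in
    \<open>E (Suc k)\<close> cost \<open>\<gamma>\<close> in total, which leaves
    \<open>\<sigma>bar / 2 - \<gamma>\<close>.\<close>
  define E where "E = (\<lambda>k. a k - b k + \<gamma> / 2 * (norm (d k))\<^sup>2)"
  have descent: "E (Suc k) + (\<sigma>bar / 2 - \<gamma>) * (norm (d (Suc k)))\<^sup>2 \<le> E k" for k
  proof -
    let ?D = "(norm (d (Suc k)))\<^sup>2"
    \<comment> \<open>The inequality for \<open>f1\<close> is based at the new iterate and tested at
      the old one, that for \<open>f2\<close> the other way round, so \<open>v k\<close> cancels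
      when they are added.\<close>
    have "a (Suc k) - (v k + \<gamma> *\<^sub>R d k) \<bullet> d (Suc k) + \<sigma>1 / 2 * (1 - t) * ?D - \<epsilon> k / t \<le> a k"
      using sigma_convex_eps_subgradient[OF cvx1 y x1 t, of k k]
      by (simp add: a_def d_Suc norm_minus_commute inner_diff_right)
    moreover have "\<epsilon> k / t \<le> lam * (\<sigma>2 / 2) * ?D / t"
      using \<epsilon>(2) t by (intro divide_right_mono) auto
    moreover have "b k + v k \<bullet> d (Suc k) + \<sigma>2 / 2 * ?D \<le> b (Suc k)"
      using sigma_convex_subgradient[OF cvx2 v x2, of k "Suc k"] by (simp add: b_def d_Suc)
    \<comment> \<open>\<open>\<sigma>bar / 2\<close> is the sum of the quadratic gains from
      \<open>f1\<close> and \<open>f2\<close> minus the loss from the error.\<close>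
    ultimately have "a (Suc k) - b (Suc k) - \<gamma> * (d k \<bullet> d (Suc k)) + \<sigma>bar / 2 * ?D \<le> a k - b k"
      unfolding assms(17) using t by (simp add: inner_add_left algebra_simps add_divide_distrib diff_divide_distrib)
    moreover have "\<gamma> * (d k \<bullet> d (Suc k)) \<le> \<gamma> * (((norm (d k))\<^sup>2 + ?D) / 2)"
    proof (rule mult_left_mono)
      have "0 \<le> (norm (d k - d (Suc k)))\<^sup>2" by simp
      then show "d k \<bullet> d (Suc k) \<le> ((norm (d k))\<^sup>2 + ?D) / 2"
        by (simp add: power2_norm_eq_inner inner_diff_left inner_diff_right inner_commute)
    qed (use \<gamma> in simp)
    ultimately show ?thesis by (simp add: E_def algebra_simps)
  qed

  \<comment> \<open>Summability and vanishing of the steps\<close>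
  have "summable (\<lambda>k. (\<sigma>bar / 2 - \<gamma>) * (norm (d (Suc k)))\<^sup>2)"
  proof (rule summable_telescoping_nonneg[where E = E and m = fstar])
    show "E (Suc k) + (\<sigma>bar / 2 - \<gamma>) * (norm (d (Suc k)))\<^sup>2 \<le> E k" for k
      by (rule descent)
    show "fstar \<le> E k" for k
      using bound[of k] \<gamma> by (simp add: E_def add_increasing2)
  qed (use \<gamma> in simp)
  \<comment> \<open>Strict positivity of \<open>\<sigma>bar / 2 - \<gamma>\<close> lets the constant
    factor be removed.\<close>
  then have sq0: "(\<lambda>k. (norm (d (Suc k)))\<^sup>2) \<longlonglongrightarrow> 0"
    using \<gamma> by (intro summable_LIMSEQ_zero) (simp add: summable_cmult_iff)
  then have "(\<lambda>k. sqrt ((norm (d (Suc k)))\<^sup>2)) \<longlonglongrightarrow> sqrt 0"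
    by (rule tendsto_real_sqrt)
  then have "(\<lambda>k. norm (d k)) \<longlonglongrightarrow> 0"
    using filterlim_sequentially_Suc[of "\<lambda>k. norm (d k)"] by simp
  then have d0: "d \<longlonglongrightarrow> 0" and part1: "(\<lambda>k. norm (x k - prev_iterate x k)) \<longlonglongrightarrow> 0"
    by (auto simp: tendsto_norm_zero_iff d_def)
  have "(\<lambda>k. lam * (\<sigma>2 / 2) * (norm (d (Suc k)))\<^sup>2) \<longlonglongrightarrow> 0"
    using sq0 tendsto_mult_right_zero by blast
  from tendsto_sandwich[OF _ _ tendsto_const this, of \<epsilon>] have \<epsilon>0: "\<epsilon> \<longlonglongrightarrow> 0"
    using \<epsilon> by auto

  \<comment> \<open>Criticality of limit points\<close>
  have "critical_point f1 f2 xbar" if "seq_limit_point xbar x" for xbar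
  proof -
    obtain r where r: "strict_mono r" "(x \<circ> r) \<longlonglongrightarrow> xbar"
      using \<open>seq_limit_point xbar x\<close> by (auto simp: seq_limit_point_def)
    \<comment> \<open>The domain of \<open>f1\<close> may fail to be closed, so the limit is caught
      in the closed set \<open>Y\<close>.\<close>
    have "xbar \<in> Y"
      using closed_sequentially[OF assms(11) _ r(2)] x1 dom1 by auto
    then have "xbar \<in> interior (eff_dom f2)" using dom2 by blast
    then obtain e B where "e > 0"
      and B: "\<And>w u. w \<in> ball xbar e \<Longrightarrow> u \<in> subdifferential f2 w \<Longrightarrow> norm u \<le> B"
      using subdifferential_locally_bounded[OF cvx2] by blast
    have "\<forall>\<^sub>F k in sequentially. (x \<circ> r) k \<in> ball xbar e"
      using \<open>e > 0\<close> by (intro topological_tendstoD[OF r(2)]) auto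
    then obtain N where N: "\<And>k. k \<ge> N \<Longrightarrow> (x \<circ> r) k \<in> ball xbar e"
      by (auto simp: eventually_sequentially)
    \<comment> \<open>Shifting by \<open>N\<close> puts every subgradient into one compact ball,
      which yields a second subsequence \<open>s\<close>; \<open>q\<close> composes both.\<close>
    have "\<forall>k. (v \<circ> r) (k + N) \<in> cball 0 B"
      using B[OF _ v] N by (simp add: o_def)
    then obtain l s where s: "strict_mono s" "((\<lambda>k. (v \<circ> r) (k + N)) \<circ> s) \<longlonglongrightarrow> l"
      using seq_compactE[OF compact_imp_seq_compact[OF compact_cball],
          of "\<lambda>k. (v \<circ> r) (k + N)" "0 :: real ^ 'n" B] by metis
    define q where "q = (\<lambda>k. r (s k + N))"
    have q: "strict_mono q"
      using r(1) s(1) by (auto simp: q_def strict_mono_def)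
    have qlim: "filterlim q sequentially sequentially"
      using q by (rule filterlim_subseq)
    have xq: "(\<lambda>k. x (q k)) \<longlonglongrightarrow> xbar"
    proof -
      have "strict_mono (\<lambda>k. s k + N)" using s(1) by (auto simp: strict_mono_def)
      then show ?thesis
        using LIMSEQ_subseq_LIMSEQ[OF r(2)] by (fastforce simp: q_def o_def)
    qed
    have vq: "(\<lambda>k. v (q k)) \<longlonglongrightarrow> l"
      using s(2) by (simp add: q_def o_def)
    have dq: "(\<lambda>k. d (q k)) \<longlonglongrightarrow> 0" "(\<lambda>k. d (Suc (q k))) \<longlonglongrightarrow> 0"
      using filterlim_compose[OF d0 qlim]
        filterlim_compose[OF filterlim_sequentially_Suc[THEN iffD2, OF d0] qlim] by auto
    \<comment> \<open>The subgradients of \<open>f1\<close> sit at \<open>x (Suc (q k))\<close>;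
      vanishing steps give these points the same limit.\<close>
    have "(\<lambda>k. x (q k) + d (Suc (q k))) \<longlonglongrightarrow> xbar + 0"
      by (intro tendsto_add xq dq)
    then have xSq: "(\<lambda>k. x (Suc (q k))) \<longlonglongrightarrow> xbar"
      by (simp add: d_Suc)
    have "(\<lambda>k. v (q k) + \<gamma> *\<^sub>R d (q k)) \<longlonglongrightarrow> l + \<gamma> *\<^sub>R 0"
      by (intro tendsto_intros vq dq)
    then have yq: "(\<lambda>k. v (q k) + \<gamma> *\<^sub>R d (q k)) \<longlonglongrightarrow> l"
      by simp
    \<comment> \<open>Inertial terms and errors both tend to 0, so the limit \<open>l\<close> of the
      subgradients of \<open>f2\<close> is an exact subgradient of \<open>f1\<close> as
      well.\<close>
    have "l \<in> eps_subdifferential 0 f1 xbar"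
      by (rule eps_subdifferential_closed_graph[OF assms(1,2) y xSq yq filterlim_compose[OF \<epsilon>0 qlim]])
    moreover have "l \<in> eps_subdifferential 0 f2 xbar"
      by (rule eps_subdifferential_closed_graph[OF assms(4,5) _ xq vq tendsto_const])
        (simp add: eps_subdifferential_0 v)
    ultimately show ?thesis
      by (auto simp: critical_point_def eps_subdifferential_0)
  qed
  with part1 show ?thesis by blast
qed

end
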